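(* The recurrence of a single-layer ISAN is rational (over the real semiring). Explicitly: let $\Sigma$ be a finite alphabet, and for each $\alpha\in\Sigma$ let $\mathbf{W}_\alpha\in\mathbb{R}^{d\times d}$ and $\mathbf{b}_\alpha\in\mathbb{R}^d$. For $\mathbf{x}=x_1\dots x_n\in\Sigma^\ast$ put $\mathbf{c}_0=\mathbf{0}$ and, for $1\le t\le n$, $$\mathbf{c}_t=\mathbf{W}_{x_t}\mathbf{c}_{t-1}+\mathbf{b}_{x_t}.$$ Then the recurrence of the function $\mathbf{c}:\Sigma^\ast\to\mathbb{R}^d$, $\mathbf{c}(\mathbf{x})=\mathbf{c}_n$, is rational.
   Context: ISAN = input switched affine network. A weighted finite-state automaton (WFSA) over a semiring $\langle\mathbb{K},\oplus,\otimes,\bar0,\bar1\rangle$ is a tuple $\mathscr{A}=\langle\Sigma,\mathcal{Q},\tau,\lambda,\rho\rangle$ with finite alphabet $\Sigma$, finite state set $\mathcal{Q}$, transition weights $\tau:\mathcal{Q}\times\mathcal{Q}\times(\Sigma\cup\{\varepsilon\})\to\mathbb{K}$ (with $\varepsilon\notin\Sigma$ marking transitions that consume no input), initial weights $\lambda:\mathcal{Q}\to\mathbb{K}$ and final weights $\rho:\mathcal{Q}\to\mathbb{K}$. A path $\bm\pi=\pi_1\dots\pi_n$ is a sequence of adjacent transitions $\pi_k=(q_k,q_{k+1},z_k)$; it derives the string obtained from $z_1\dots z_n$ by deleting all $\varepsilon$'s (a path with no transitions sits at a single state $q_1$ and derives the empty string). Its score is $\mathscr{A}[\bm\pi]=\lambda(q_1)\otimes\bigl(\bigotimes_{k=1}^n\tau(\pi_k)\bigr)\otimes\rho(q_{n+1})$.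 The score of a string $\mathbf{x}$ is $\mathscr{A}\llbracket\mathbf{x}\rrbracket=\bigoplus_{\bm\pi}\mathscr{A}[\bm\pi]$, summed over all paths deriving $\mathbf{x}$ (transitions of weight $\bar0$ are regarded as absent; if there is a cycle of $\varepsilon$-transitions, the number of consecutive $\varepsilon$-transitions must be capped or infinite sums must make sense in $\mathbb{K}$). Rational recurrence: the recurrence of a function $\mathbf{c}:\Sigma^\ast\to\mathbb{K}^d$ is rational if there is a set of WFSAs $\{\mathscr{A}_i\}_{i=1}^d$ over alphabet $\Sigma$ and semiring $\langle\mathbb{K},\oplus,\otimes,\bar0,\bar1\rangle$, with $\oplus$ and $\otimes$ taking constant time and space, such that $[\mathbf{c}(\mathbf{x})]_i=\mathscr{A}_i\llbracket\mathbf{x}\rrbracket$ for all $\mathbf{x}\in\Sigma^\ast$ and all $i\in\{1,\dots,d\}$. Here $\mathbb{K}=\mathbb{R}$ carries the real semiring $\langle\mathbb{R},+,\cdot,0,1\rangle$, whose operations are counted as constant time and space. *)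

theory Defs
  imports "HOL-Analysis.Analysis"
begin

text \<open>A transition label is \<open>Some a\<close> for a letter \<open>a\<close>, and \<open>None\<close> for the empty word
  (a transition that consumes no input).\<close>

record ('q, 'a, 'k) wfsa =
  alphabet :: "'a set"
  states :: "'q set"
  weight :: "'q \<times> 'q \<times> 'a option \<Rightarrow> 'k"
  initial :: "'q \<Rightarrow> 'k"
  final :: "'q \<Rightarrow> 'k"

definition finite_wfsa :: "('q, 'a, 'k) wfsa \<Rightarrow> bool" where
  "finite_wfsa A \<longleftrightarrow> finite (alphabet A) \<and> finite (states A)"

text \<open>A path is its first state together with its list of transitions; the first state is
  recorded separately so that a path without transitions still sits at a definite state.
  Transitions of weight zero count as absent.\<close>

fun is_path :: "('q, 'a, 'k::zero) wfsa \<Rightarrow> 'q \<Rightarrow> ('q \<times> 'q \<times> 'a option) list \<Rightarrow> bool" where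
  "is_path A q [] \<longleftrightarrow> q \<in> states A"
| "is_path A q ((p, r, z) # ts) \<longleftrightarrow>
     p = q \<and> q \<in> states A \<and> z \<in> insert None (Some ` alphabet A) \<and> weight A (p, r, z) \<noteq> 0 \<and>
     is_path A r ts"

fun path_end :: "'q \<Rightarrow> ('q \<times> 'q \<times> 'a option) list \<Rightarrow> 'q" where
  "path_end q [] = q"
| "path_end q ((p, r, z) # ts) = path_end r ts"

definition derived_string :: "('q \<times> 'q \<times> 'a option) list \<Rightarrow> 'a list" where
  "derived_string ts = List.map_filter (\<lambda>(p, r, z). z) ts"

definition paths :: "('q, 'a, 'k::zero) wfsa \<Rightarrow> 'a list \<Rightarrow> ('q \<times> ('q \<times> 'q \<times> 'a option) list) set" where
  "paths A x = {(q, ts). is_path A q ts \<and> derived_string ts = x}"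

definition path_score ::
  "('q, 'a, 'k::semiring_1) wfsa \<Rightarrow> 'q \<times> ('q \<times> 'q \<times> 'a option) list \<Rightarrow> 'k" where
  "path_score A = (\<lambda>(q, ts).
     initial A q * prod_list (map (weight A) ts) * final A (path_end q ts))"

text \<open>Cycles of transitions labelled \<open>None\<close> can make the set of paths infinite. The sum over
  paths is therefore an unordered infinite sum in the topology of the semiring, and
  \<open>score_defined\<close> has to accompany \<open>string_score\<close>, since \<open>infsum\<close> is zero on divergent
  families. Where only finitely many paths derive the string, this is the ordinary finite sum.\<close>

definition score_defined :: "('q, 'a, 'k::{semiring_1,t2_space}) wfsa \<Rightarrow> 'a list \<Rightarrow> bool" where
  "score_defined A x \<longleftrightarrow> path_score A summable_on paths A x"

definition string_score :: "('q, 'a, 'k::{semiring_1,t2_space}) wfsa \<Rightarrow> 'a list \<Rightarrow> 'k" where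
  "string_score A x = (\<Sum>\<^sub>\<infinity>\<pi>\<in>paths A x. path_score A \<pi>)"

text \<open>Taking natural numbers as states is no restriction, because state sets are finite.
  The semiring operations are by convention counted as constant time and space, so this
  requirement does not appear as a condition on the function.\<close>

definition rational_recurrence ::
  "'a set \<Rightarrow> ('a list \<Rightarrow> ('k::{semiring_1,t2_space}) ^ 'n) \<Rightarrow> bool" where
  "rational_recurrence \<Sigma> c \<longleftrightarrow>
     (\<exists>A :: 'n \<Rightarrow> (nat, 'a, 'k) wfsa. \<forall>i.
        finite_wfsa (A i) \<and> alphabet (A i) = \<Sigma> \<and>
        (\<forall>x\<in>lists \<Sigma>. score_defined (A i) x \<and> c x $ i = string_score (A i) x))"

text \<open>\<open>isan_state W b x t\<close> is the state after \<open>t\<close> letters of \<open>x\<close>, meaningful for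
  \<open>t \<le> length x\<close>. Lists are indexed from 0, so letter \<open>t + 1\<close> is \<open>x ! t\<close>.\<close>

primrec isan_state ::
  "('a \<Rightarrow> real ^ 'n ^ 'n) \<Rightarrow> ('a \<Rightarrow> real ^ 'n) \<Rightarrow> 'a list \<Rightarrow> nat \<Rightarrow> real ^ 'n" where
  "isan_state W b x 0 = 0"
| "isan_state W b x (Suc t) = W (x ! t) *v isan_state W b x t + b (x ! t)"

definition isan :: "('a \<Rightarrow> real ^ 'n ^ 'n) \<Rightarrow> ('a \<Rightarrow> real ^ 'n) \<Rightarrow> 'a list \<Rightarrow> real ^ 'n" where
  "isan W b x = isan_state W b x (length x)"

end

theory Submission
  imports Defs
begin

text \<open>Appending a constant coordinate 1 to the hidden state turns the affine updates into linear
  ones. An automaton without empty transitions multiplies the corresponding matrices: its states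
  are the coordinates, with \<open>None\<close> for the constant one, which is the only state with nonzero
  initial weight. The automaton for coordinate \<open>i\<close> has final weight 1 at \<open>i\<close> alone.\<close>

definition paths_from ::
  "('q, 'a, 'k::zero) wfsa \<Rightarrow> 'q \<Rightarrow> 'a list \<Rightarrow> ('q \<times> 'q \<times> 'a option) list set" where
  "paths_from A q x = {ts. is_path A q ts \<and> derived_string ts = x}"

definition epsilon_free :: "('q, 'a, 'k::zero) wfsa \<Rightarrow> bool" where
  "epsilon_free A \<longleftrightarrow> (\<forall>p r. weight A (p, r, None) = 0)"

text \<open>The backward vector of dynamic programming: the total weight of all ways to read the
  rest of the word from a given state, final weight included. Only letter transitions enter, so this
  reading presupposes \<open>epsilon_free\<close>.\<close>

primrec backward_weight :: "('q, 'a, 'k::semiring_1) wfsa \<Rightarrow> 'q \<Rightarrow> 'a list \<Rightarrow> 'k" where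
  "backward_weight A q [] = final A q"
| "backward_weight A q (a # x) =
     (\<Sum>r\<in>states A. weight A (q, r, Some a) * backward_weight A r x)"

lemma derived_string_simps [simp]:
  "derived_string [] = []"
  "derived_string ((p, r, None) # ts) = derived_string ts"
  "derived_string ((p, r, Some a) # ts) = a # derived_string ts"
  by (simp_all add: derived_string_def List.map_filter_simps)

lemma is_path_start: "is_path A q ts \<Longrightarrow> q \<in> states A"
  by (cases ts) auto

lemma paths_from_Nil:
  assumes "epsilon_free A" "q \<in> states A"
  shows "paths_from A q [] = {[]}"
proof -
  have "ts = []" if "is_path A q ts" "derived_string ts = []" for ts
    using that assms(1) by (cases ts) (auto simp: epsilon_free_def)
  then show ?thesis
    using assms(2) by (auto simp: paths_from_def)
qed

text \<open>Without empty transitions the first transition must consume \<open>a\<close>, and the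
  rest is a path from its target. Targets of weight zero drop out because \<open>is_path\<close>
  rejects such transitions.\<close>

lemma paths_from_Cons:
  assumes "epsilon_free A" "q \<in> states A" "a \<in> alphabet A"
  shows "paths_from A q (a # x) =
    (\<lambda>(r, ts). (q, r, Some a) # ts) `
      (SIGMA r:{r \<in> states A. weight A (q, r, Some a) \<noteq> 0}. paths_from A r x)"
proof (intro equalityI subsetI)
  fix ts assume ts: "ts \<in> paths_from A q (a # x)"
  then obtain p r z us where "ts = (p, r, z) # us"
    by (cases ts) (auto simp: paths_from_def)
  with ts assms(1) show "ts \<in> (\<lambda>(r, ts). (q, r, Some a) # ts) `
      (SIGMA r:{r \<in> states A. weight A (q, r, Some a) \<noteq> 0}. paths_from A r x)"
    by (auto simp: paths_from_def epsilon_free_def dest: is_path_start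
        intro!: image_eqI[where x = "(r, us)"])
next
  fix ts assume "ts \<in> (\<lambda>(r, ts). (q, r, Some a) # ts) `
      (SIGMA r:{r \<in> states A. weight A (q, r, Some a) \<noteq> 0}. paths_from A r x)"
  with assms(2,3) show "ts \<in> paths_from A q (a # x)"
    by (auto simp: paths_from_def)
qed

text \<open>Each letter offers finitely many targets. This finiteness gives summability and turns
  the infinite sum in \<open>string_score\<close> into an ordinary one.\<close>

lemma finite_paths_from:
  assumes "epsilon_free A" "finite (states A)" "q \<in> states A" "x \<in> lists (alphabet A)"
  shows "finite (paths_from A q x)"
  using assms(4,3)
proof (induction x arbitrary: q)
  case Nil
  then show ?case by (simp add: paths_from_Nil assms(1))
next
  case (Cons a x)
  then show ?case
    using assms(2) by (auto simp: paths_from_Cons assms(1) intro!: finite_imageI finite_SigmaI)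
qed

text \<open>By distributivity, the weight of a first transition factors out of the sum over all
  paths that begin with it.\<close>

lemma sum_paths_from:
  assumes "epsilon_free A" "finite (states A)" "q \<in> states A" "x \<in> lists (alphabet A)"
  shows "(\<Sum>ts\<in>paths_from A q x. prod_list (map (weight A) ts) * final A (path_end q ts)) =
    backward_weight A q x"
  using assms(4,3)
proof (induction x arbitrary: q)
  case Nil
  then show ?case by (simp add: paths_from_Nil assms(1))
next
  case (Cons a x)
  let ?R = "{r \<in> states A. weight A (q, r, Some a) \<noteq> 0}"
  let ?F = "\<lambda>q ts. prod_list (map (weight A) ts) * final A (path_end q ts)"
  have "(\<Sum>ts\<in>paths_from A q (a # x). ?F q ts) =
      (\<Sum>(r, ts)\<in>(SIGMA r:?R. paths_from A r x). weight A (q, r, Some a) * ?F r ts)"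
    using Cons by (subst paths_from_Cons[OF assms(1)], simp, simp, subst sum.reindex)
      (auto simp: inj_on_def mult.assoc intro!: sum.cong)
  also have "\<dots> = (\<Sum>r\<in>?R. \<Sum>ts\<in>paths_from A r x. weight A (q, r, Some a) * ?F r ts)"
    using assms(1,2) Cons.hyps by (intro sum.Sigma[symmetric]) (auto intro!: finite_paths_from)
  also have "\<dots> = (\<Sum>r\<in>?R. weight A (q, r, Some a) * backward_weight A r x)"
    using Cons.IH by (intro sum.cong) (auto simp: sum_distrib_left[symmetric])
  \<comment> \<open>Targets of weight zero rejoin the sum, contributing nothing.\<close>
  also have "\<dots> = backward_weight A q (a # x)"
    using assms(2) by (auto intro!: sum.mono_neutral_left)
  finally show ?case .
qed

lemma epsilon_free_score:
  fixes A :: "('q, 'a, 'k::{semiring_1,t2_space}) wfsa"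
  assumes "epsilon_free A" "finite (states A)" "x \<in> lists (alphabet A)"
  shows "score_defined A x"
    and "string_score A x = (\<Sum>q\<in>states A. initial A q * backward_weight A q x)"
proof -
  have paths: "paths A x = (SIGMA q:states A. paths_from A q x)"
    by (auto simp: paths_def paths_from_def dest: is_path_start)
  have fin: "finite (paths A x)"
    unfolding paths using assms by (auto intro!: finite_paths_from)
  then show "score_defined A x"
    by (simp add: score_defined_def summable_on_finite)
  have "string_score A x = (\<Sum>(q, ts)\<in>(SIGMA q:states A. paths_from A q x). path_score A (q, ts))"
    using fin by (simp add: string_score_def paths)
  also have "\<dots> = (\<Sum>q\<in>states A. \<Sum>ts\<in>paths_from A q x. path_score A (q, ts))"
    using assms by (intro sum.Sigma[symmetric]) (auto intro!: finite_paths_from)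
  also have "\<dots> = (\<Sum>q\<in>states A. initial A q * backward_weight A q x)"
    using assms
    by (intro sum.cong)
      (simp_all add: path_score_def mult.assoc sum_distrib_left[symmetric] sum_paths_from)
  finally show "string_score A x = (\<Sum>q\<in>states A. initial A q * backward_weight A q x)" .
qed

text \<open>A fold makes the current vector an accumulator, so that a later induction on the word
  can vary the starting vector.\<close>

lemma isan_eq_fold: "isan W b x = fold (\<lambda>a c. W a *v c + b a) x 0"
proof -
  have "isan_state W b x t = fold (\<lambda>a c. W a *v c + b a) (take t x) 0" if "t \<le> length x" for t
    using that by (induction t) (auto simp: take_Suc_conv_app_nth)
  then show ?thesis by (simp add: isan_def)
qed

text \<open>Homogeneous coordinates: the block matrix with rows \<open>(M v)\<close> and
  \<open>(0 1)\<close>, row index before column index.\<close>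

fun augmented_entry ::
  "real ^ 'n ^ 'n \<Rightarrow> real ^ 'n \<Rightarrow> 'n option \<Rightarrow> 'n option \<Rightarrow> real" where
  "augmented_entry M v (Some i) (Some j) = M $ i $ j"
| "augmented_entry M v (Some i) None = v $ i"
| "augmented_entry M v None (Some j) = 0"
| "augmented_entry M v None None = 1"

text \<open>The injection \<open>f\<close> only encodes the coordinates as states of the required type. Automata read
  a transition from source to target, so matrix entries appear transposed.\<close>

definition isan_wfsa ::
  "('n option \<Rightarrow> 'q) \<Rightarrow> 'a set \<Rightarrow> ('a \<Rightarrow> real ^ 'n ^ 'n) \<Rightarrow> ('a \<Rightarrow> real ^ 'n) \<Rightarrow> 'n \<Rightarrow>
    ('q, 'a, real) wfsa" where
  "isan_wfsa f \<Sigma> W b i =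
    \<lparr>alphabet = \<Sigma>, states = range f,
     weight = (\<lambda>(p, r, z). case z of None \<Rightarrow> 0
       | Some a \<Rightarrow> augmented_entry (W a) (b a) (inv f r) (inv f p)),
     initial = (\<lambda>q. if q = f None then 1 else 0),
     final = (\<lambda>q. if q = f (Some i) then 1 else 0)\<rparr>"

lemma sum_UNIV_option:
  "(\<Sum>q\<in>(UNIV :: 'n::finite option set). g q) = g None + (\<Sum>j\<in>UNIV. g (Some j))"
  by (simp add: UNIV_option_conv sum.reindex)

text \<open>The left side pairs \<open>(c, 1)\<close> with the vector of backward weights. Reading
  \<open>a\<close> moves its matrix across this pairing, taking \<open>(c, 1)\<close> to
  \<open>(W a *v c + b a, 1)\<close>; hence \<open>c\<close> stays arbitrary in the
  induction.\<close>

lemma backward_weight_isan_wfsa: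
  fixes f :: "'n::finite option \<Rightarrow> 'q" and c :: "real ^ 'n"
  assumes "inj f"
  shows "(\<Sum>j\<in>UNIV. c $ j * backward_weight (isan_wfsa f \<Sigma> W b i) (f (Some j)) x) +
      backward_weight (isan_wfsa f \<Sigma> W b i) (f None) x =
    fold (\<lambda>a c. W a *v c + b a) x c $ i"
proof (induction x arbitrary: c)
  case Nil
  have "(\<Sum>j\<in>UNIV. c $ j * (if j = i then 1 else 0)) = c $ i"
    by (simp add: if_distrib cong: if_cong)
  then show ?case
    using assms by (simp add: isan_wfsa_def inj_eq)
next
  case (Cons a x)
  let ?B = "\<lambda>q. backward_weight (isan_wfsa f \<Sigma> W b i) (f q)"
  have step: "?B p (a # x) = augmented_entry (W a) (b a) None p * ?B None x +
      (\<Sum>k\<in>UNIV. augmented_entry (W a) (b a) (Some k) p * ?B (Some k) x)" for p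
  proof -
    have "?B p (a # x) =
        (\<Sum>r\<in>range f. augmented_entry (W a) (b a) (inv f r) p *
          backward_weight (isan_wfsa f \<Sigma> W b i) r x)"
      using assms by (simp add: isan_wfsa_def)
    also have "\<dots> = (\<Sum>q\<in>UNIV. augmented_entry (W a) (b a) q p * ?B q x)"
      using assms by (simp add: sum.reindex)
    finally show ?thesis by (simp add: sum_UNIV_option)
  qed
  \<comment> \<open>The entry 0 in row \<open>None\<close> removes every transition from
    \<open>Some j\<close> to \<open>None\<close>.\<close>
  have "(\<Sum>j\<in>UNIV. c $ j * ?B (Some j) (a # x)) =
      (\<Sum>j\<in>UNIV. \<Sum>k\<in>UNIV. W a $ k $ j * c $ j * ?B (Some k) x)"
    unfolding step by (simp add: sum_distrib_left mult_ac)
  also have "\<dots> = (\<Sum>k\<in>UNIV. (W a *v c) $ k * ?B (Some k) x)"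
    by (subst sum.swap) (simp add: matrix_vector_mult_def sum_distrib_right)
  \<comment> \<open>Column \<open>None\<close> supplies \<open>b a\<close>, and its last entry 1
    preserves the constant coordinate.\<close>
  finally have "(\<Sum>j\<in>UNIV. c $ j * ?B (Some j) (a # x)) + ?B None (a # x) =
      (\<Sum>k\<in>UNIV. (W a *v c + b a) $ k * ?B (Some k) x) + ?B None x"
    unfolding step[of None] by (simp add: distrib_right sum.distrib)
  then show ?case
    using Cons.IH[of "W a *v c + b a"] by simp
qed

lemma string_score_isan_wfsa:
  fixes f :: "'n::finite option \<Rightarrow> 'q"
  assumes "inj f" "x \<in> lists \<Sigma>"
  shows "score_defined (isan_wfsa f \<Sigma> W b i) x"
    and "string_score (isan_wfsa f \<Sigma> W b i) x = isan W b x $ i"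
proof -
  let ?A = "isan_wfsa f \<Sigma> W b i"
  have A: "epsilon_free ?A" "finite (states ?A)" "x \<in> lists (alphabet ?A)"
    using assms(2) by (simp_all add: epsilon_free_def isan_wfsa_def)
  show "score_defined ?A x"
    using A by (rule epsilon_free_score)
  have "string_score ?A x = (\<Sum>q\<in>range f. initial ?A q * backward_weight ?A q x)"
    using epsilon_free_score(2)[OF A] by (simp add: isan_wfsa_def)
  also have "\<dots> = (\<Sum>p\<in>UNIV. initial ?A (f p) * backward_weight ?A (f p) x)"
    using assms(1) by (simp add: sum.reindex)
  also have "\<dots> = backward_weight ?A (f None) x"
    using assms(1) by (simp add: sum_UNIV_option isan_wfsa_def inj_eq)
  \<comment> \<open>With starting vector 0 only the \<open>None\<close> term of the pairing
    survives.\<close>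
  also have "\<dots> = isan W b x $ i"
    using backward_weight_isan_wfsa[OF assms(1), of 0 \<Sigma> W b i x] by (simp add: isan_eq_fold)
  finally show "string_score ?A x = isan W b x $ i" .
qed

theorem proposition13:
  fixes \<Sigma> :: "'a set"
    and W :: "'a \<Rightarrow> real ^ 'n ^ 'n"
    and b :: "'a \<Rightarrow> real ^ 'n"
  assumes "finite \<Sigma>"
  shows "rational_recurrence \<Sigma> (isan W b)"
proof -
  \<comment> \<open>The index type of a vector is finite, hence so is its option type, which
    therefore embeds into the naturals. One \<open>f\<close> serves all coordinates.\<close>
  obtain f :: "'n option \<Rightarrow> nat" where f: "inj f"
    using finite_imp_inj_to_nat_seg[of "UNIV :: 'n option set"] by auto
  have "finite_wfsa (isan_wfsa f \<Sigma> W b i)" "alphabet (isan_wfsa f \<Sigma> W b i) = \<Sigma>" for i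
    using assms by (simp_all add: finite_wfsa_def isan_wfsa_def)
  then show ?thesis
    unfolding rational_recurrence_def
    by (intro exI[of _ "isan_wfsa f \<Sigma> W b"]) (simp add: string_score_isan_wfsa[OF f])
qed

end
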